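(* Let $B=\{1,2,\dots,15\}\in\triangle_5$. If $X,Y\subseteq B$ are disjoint, then it is not the case that both $X$ contains some element of $\triangle_3(B)$ and $Y$ contains some element of $\triangle_3(B)$. (That is, in Mines$_5(3)$ both players cannot construct a $\triangle_3$.)
   Context: $T_n=n(n+1)/2$, $T_0=0$. A finite set $X\subseteq\mathbb{N}$ with $|X|=T_n$, enumerated $x_1<\dots<x_{T_n}$, has $i$-th level $\{x_{T_{i-1}+1},\dots,x_{T_i}\}$ for $1\le i\le n$; $\triangle_n$ is the set of all $X\subseteq\mathbb{N}$ with $|X|=T_n$. For such sets, $X\le Y$ means $X\subseteq Y$ and every level of $X$ is contained in a single level of $Y$, distinct levels of $X$ being contained in distinct levels of $Y$; $\triangle_k(B)=\{Z\in\triangle_k:Z\le B\}$. *)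

theory Defs
  imports Main
begin

definition T :: "nat \<Rightarrow> nat" where
  "T n = n * (n + 1) div 2"

definition triangles :: "nat \<Rightarrow> nat set set" where
  "triangles n = {X. finite X \<and> card X = T n}"

text \<open>
  Levels are numbered from 1, while list positions are numbered from 0; so the elements
  \<open>x\<^sub>j\<close> with \<open>T (i - 1) + 1 \<le> j \<le> T i\<close> sit at the positions \<open>{T (i - 1)..<T i}\<close>.
\<close>
definition level :: "nat set \<Rightarrow> nat \<Rightarrow> nat set" where
  "level X i = (\<lambda>j. sorted_list_of_set X ! j) ` {T (i - 1)..<T i}"

text \<open>
  The numbers of levels \<open>m\<close> and \<open>n\<close> are determined by \<open>X\<close> and \<open>Y\<close>, since \<open>T\<close> is injective.
  The map \<open>f\<close> sends (the index of) a level of \<open>X\<close> to that of the level of \<open>Y\<close> containing it.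
\<close>
definition tri_le :: "nat set \<Rightarrow> nat set \<Rightarrow> bool" where
  "tri_le X Y \<longleftrightarrow>
     (\<exists>m n. X \<in> triangles m \<and> Y \<in> triangles n \<and> X \<subseteq> Y \<and>
        (\<exists>f. f ` {1..m} \<subseteq> {1..n} \<and> inj_on f {1..m} \<and>
             (\<forall>i\<in>{1..m}. level X i \<subseteq> level Y (f i))))"

definition triangles_in :: "nat \<Rightarrow> nat set \<Rightarrow> nat set set" where
  "triangles_in k B = {Z \<in> triangles k. tri_le Z B}"

lemma atLeastAtMost_15_in_triangles: "{1..15} \<in> triangles 5"
  by (simp add: triangles_def T_def)

lemma levels_atLeastAtMost_15:
  "level {1..15} 1 = {1}"
  "level {1..15} 2 = {2, 3}"
  "level {1..15} 3 = {4, 5, 6}"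
  "level {1..15} 4 = {7, 8, 9, 10}"
  "level {1..15} 5 = {11, 12, 13, 14, 15}"
proof -
  have list: "sorted_list_of_set {1..15::nat} = [1..<16]"
  proof -
    have "{1..15::nat} = {1..<16}" by auto
    then show ?thesis by simp
  qed
  have level: "level {1..15} i = {T (i - 1) + 1..T i}" if "T i \<le> 15" for i
  proof -
    have "level {1..15} i = (\<lambda>j. j + 1) ` {T (i - 1)..<T i}"
      unfolding level_def list using that by (intro image_cong refl) (auto simp del: upt_Suc)
    also have "\<dots> = {T (i - 1) + 1..T i}"
      by (simp add: image_Suc_atLeastLessThan atLeastLessThanSuc_atLeastAtMost)
    finally show ?thesis .
  qed
  show "level {1..15} 1 = {1}" "level {1..15} 2 = {2, 3}" "level {1..15} 3 = {4, 5, 6}"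
    "level {1..15} 4 = {7, 8, 9, 10}" "level {1..15} 5 = {11, 12, 13, 14, 15}"
    by (subst level; auto simp: T_def)+
qed

end

(* The levels of Z \<le> B lie in levels of B in increasing order, so an element of \<triangle>_3(B)
   needs one, two and three elements from levels a < b < c of B. Level i of B has i elements,
   so two disjoint such sets have their largest levels in different levels of B. If one of these
   is level 3, then that set exhausts the levels 1, 2, 3 and the other does not fit into 4, 5.
   Otherwise they are in the levels 4 and 5, with at most one element of level 4 left over;
   so both pairs are in levels 2 and 3, not both in the same one, and the set with its
   pair in level 2 exhausts the levels 1 and 2, leaving no single element for the other. *)

theory Submission
  imports Defs
begin

lemma T_Suc: "T (Suc n) = T n + Suc n"
  by (simp add: T_def)

lemma strict_mono_T: "strict_mono T"
  by (simp add: strict_mono_Suc_iff T_Suc)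

lemma T_diff_one: "T i - T (i - 1) = i"
  \<comment> \<open>At \<open>i = 0\<close> truncated subtraction makes both terms
    \<open>T 0\<close>, so the identity survives without assuming that \<open>i\<close> is
    positive.\<close>
  by (cases i) (simp_all add: T_Suc T_def[of 0])

lemma T_le_T_diff_one: "i < j \<Longrightarrow> T i \<le> T (j - 1)"
  using strict_mono_mono[OF strict_mono_T] by (simp add: monoD)

lemma T_le_iff: "T i \<le> T j \<longleftrightarrow> i \<le> j"
  using strict_mono_T by (rule strict_mono_less_eq)

text \<open>Level \<open>i\<close> ends at position \<open>T i\<close>, no later than level
  \<open>j\<close> starts, and the sorted list is strictly increasing.\<close>

lemma level_less:
  assumes "X \<in> triangles n" "i < j" "j \<le> n" "x \<in> level X i" "y \<in> level X j"
  shows "x < y"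
proof -
  from assms(4,5) obtain p q
    where p: "p < T i" "x = sorted_list_of_set X ! p"
      and q: "T (j - 1) \<le> q" "q < T j" "y = sorted_list_of_set X ! q"
    by (auto simp: level_def)
  have "p < q"
    using p(1) q(1) T_le_T_diff_one[OF assms(2)] by linarith
  moreover have "q < length (sorted_list_of_set X)"
    \<comment> \<open>The list has length \<open>T n\<close>; \<open>j \<le> n\<close> keeps
      \<open>q\<close> within it, since \<open>!\<close> is unspecified beyond the end.\<close>
    using q(2) assms(1,3) T_le_iff[of j n] by (simp add: triangles_def)
  ultimately show ?thesis
    using strict_sorted_list_of_set[of X] p(2) q(3) by (simp add: sorted_wrt_nth_less)
qed

lemma card_level:
  assumes "X \<in> triangles n" "i \<le> n"
  shows "card (level X i) = i"
proof -
  have "T i \<le> length (sorted_list_of_set X)"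
    using assms T_le_iff[of i n] by (simp add: triangles_def)
  then have "inj_on (\<lambda>j. sorted_list_of_set X ! j) {T (i - 1)..<T i}"
    by (intro inj_on_nth) auto
  then show ?thesis
    unfolding level_def by (simp only: card_image card_atLeastLessThan T_diff_one)
qed

lemma level_subset:
  assumes "X \<in> triangles n" "i \<le> n"
  shows "level X i \<subseteq> X"
proof -
  have "T i \<le> length (sorted_list_of_set X)" "finite X"
    using assms T_le_iff[of i n] by (simp_all add: triangles_def)
  then show ?thesis
    using nth_mem[of _ "sorted_list_of_set X"] by (auto simp: level_def)
qed

lemma triangles_inj: "X \<in> triangles m \<Longrightarrow> X \<in> triangles n \<Longrightarrow> m = n"
  using strict_mono_eq[OF strict_mono_T] by (auto simp: triangles_def)

text \<open>Injectivity of the level map improves to monotonicity: if \<open>f\<close> reversed two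
  levels, elements chosen from them would be ordered one way by the levels of \<open>Z\<close> and
  the other way by those of \<open>B\<close>. Only cardinalities are kept, as the rest is
  counting.\<close>

lemma triangles_in_strict_mono:
  assumes "Z \<in> triangles_in k B" "B \<in> triangles n"
  obtains f where "f ` {1..k} \<subseteq> {1..n}" "strict_mono_on {1..k} f"
    "\<And>i. i \<in> {1..k} \<Longrightarrow> i \<le> card (Z \<inter> level B (f i))"
proof -
  have Z: "Z \<in> triangles k"
    using assms(1) by (simp add: triangles_in_def)
  obtain f where f: "f ` {1..k} \<subseteq> {1..n}" "inj_on f {1..k}"
      "\<And>i. i \<in> {1..k} \<Longrightarrow> level Z i \<subseteq> level B (f i)"
  proof -
    from assms(1) obtain k' n' f where "Z \<in> triangles k'" "B \<in> triangles n'"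
        and f: "f ` {1..k'} \<subseteq> {1..n'}" "inj_on f {1..k'}"
          "\<forall>i\<in>{1..k'}. level Z i \<subseteq> level B (f i)"
      unfolding triangles_in_def tri_le_def by auto
    \<comment> \<open>\<open>tri_le\<close> quantifies over its own numbers of levels; cardinality
      identifies them with \<open>k\<close> and \<open>n\<close>.\<close>
    then have "k' = k" "n' = n"
      using triangles_inj Z assms(2) by auto
    with f show thesis
      by (intro that[of f]) auto
  qed
  have "f i < f j" if ij: "i \<in> {1..k}" "j \<in> {1..k}" "i < j" for i j
  proof (rule ccontr)
    assume "\<not> f i < f j"
    moreover have "f i \<noteq> f j"
      using f(2) ij by (metis inj_onD less_irrefl)
    ultimately have gt: "f j < f i" by simp
    have "level Z i \<noteq> {}" "level Z j \<noteq> {}"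
      using card_level[OF Z, of i] card_level[OF Z, of j] ij by auto
    then obtain x y where xy: "x \<in> level Z i" "y \<in> level Z j" by blast
    have "x < y"
      using level_less[OF Z ij(3) _ xy] ij by simp
    moreover have "y < x"
    proof (rule level_less[OF assms(2) gt])
      show "f i \<le> n"
        using f(1) ij(1) by (auto simp: image_subset_iff)
    qed (use f(3)[OF ij(1)] f(3)[OF ij(2)] xy in auto)
    ultimately show False by simp
  qed
  then have "strict_mono_on {1..k} f"
    by (simp add: strict_mono_on_def)
  moreover have "i \<le> card (Z \<inter> level B (f i))" if i: "i \<in> {1..k}" for i
  proof -
    have "level Z i \<subseteq> Z \<inter> level B (f i)"
      using level_subset[OF Z, of i] f(3)[OF i] i by auto
    moreover have "finite Z"
      using Z by (simp add: triangles_def)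
    ultimately show ?thesis
      using card_mono[of "Z \<inter> level B (f i)" "level Z i"] card_level[OF Z, of i] i by simp
  qed
  ultimately show thesis
    using f(1) that by blast
qed

lemma triangles_in_3_5:
  assumes "Z \<in> triangles_in 3 B" "B \<in> triangles 5"
  obtains a b c where "1 \<le> a" "a < b" "b < c" "c \<le> 5"
    "1 \<le> card (Z \<inter> level B a)" "2 \<le> card (Z \<inter> level B b)" "3 \<le> card (Z \<inter> level B c)"
proof -
  obtain f where f: "f ` {1..3} \<subseteq> {1..5}" "strict_mono_on {1..3} f"
      "\<And>i. i \<in> {1..3} \<Longrightarrow> i \<le> card (Z \<inter> level B (f i))"
    using triangles_in_strict_mono[OF assms] by blast
  show thesis
    using f(1) strict_mono_onD[OF f(2), of 1 2] strict_mono_onD[OF f(2), of 2 3]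
      f(3)[of 1] f(3)[of 2] f(3)[of 3]
    by (intro that[of "f 1" "f 2" "f 3"]) (auto simp: image_subset_iff)
qed

lemma card_Int_disjoint_le:
  assumes "finite A" "Z \<inter> W = {}"
  shows "card (Z \<inter> A) + card (W \<inter> A) \<le> card A"
proof -
  have "card (Z \<inter> A) + card (W \<inter> A) = card ((Z \<inter> A) \<union> (W \<inter> A))"
    using assms by (intro card_Un_disjoint[symmetric]) auto
  also have "\<dots> \<le> card A"
    using assms(1) by (intro card_mono) auto
  finally show ?thesis .
qed

text \<open>The counting argument in pure arithmetic: \<open>x i\<close> and \<open>y i\<close>
  stand for the elements that two disjoint sets take from level \<open>i\<close>, whose capacity is
  \<open>i\<close>. The order \<open>c < c'\<close> is a choice of names.\<close>

lemma level_capacities_exceeded: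
  fixes x y :: "nat \<Rightarrow> nat"
  assumes "1 \<le> a" "a < b" "b < c" "c < c'" "c' \<le> 5" "1 \<le> a'" "a' < b'" "b' < c'"
    and "1 \<le> x a" "2 \<le> x b" "3 \<le> x c" "1 \<le> y a'" "2 \<le> y b'" "3 \<le> y c'"
    and xy: "\<And>i. i \<le> 5 \<Longrightarrow> x i + y i \<le> i"
  shows False
proof -
  have "c = 3 \<or> c = 4" using assms(1-5) by linarith
  then show False
  proof
    assume c: "c = 3"
    then have "b = 2" "a = 1" using assms(1-3) by linarith+
    then have "y 1 = 0" "y 2 = 0" "y 3 = 0"
      using c assms(9-11) xy[of 1] xy[of 2] xy[of 3] by simp_all
    \<comment> \<open>Two further levels lie above \<open>a'\<close>, and there are only
      five.\<close>
    moreover have "a' = 1 \<or> a' = 2 \<or> a' = 3" using assms(5-8) by linarith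
    ultimately show False using assms(12) by auto
  next
    assume c: "c = 4"
    then have c': "c' = 5" using assms(4,5) by linarith
    have "y 4 \<le> 1" using c assms(11) xy[of 4] by simp
    then have "b' \<noteq> 4" using assms(13) by auto
    then have b': "b' = 2 \<or> b' = 3" using c' assms(6-8) by linarith
    have b: "b = 2 \<or> b = 3" using c assms(1-3) by linarith
    \<comment> \<open>Two pairs in one level would need capacity 4, but \<open>b\<close> is at most
      3.\<close>
    have "b \<noteq> b'" using assms(10,13) xy[of b] b by auto
    then consider "b = 2" "b' = 3" | "b = 3" "b' = 2" using b b' by auto
    then show False
    proof cases
      case 1
      then have "a = 1" using assms(1,2) by linarith
      then have "y 1 = 0" "y 2 = 0" using 1 assms(9,10) xy[of 1] xy[of 2] by simp_all
      moreover have "a' = 1 \<or> a' = 2" using 1 assms(6,7) by linarith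
      ultimately show False using assms(12) by auto
    next
      case 2
      then have "a' = 1" using assms(6,7) by linarith
      then have "x 1 = 0" "x 2 = 0" using 2 assms(12,13) xy[of 1] xy[of 2] by simp_all
      moreover have "a = 1 \<or> a = 2" using 2 assms(1,2) by linarith
      ultimately show False using assms(9) by auto
    qed
  qed
qed

theorem theorem5:
  fixes B X Y :: "nat set"
  assumes "B = {1..15}"
    and "X \<subseteq> B" and "Y \<subseteq> B"
    and "X \<inter> Y = {}"
  shows "\<not> ((\<exists>Z\<in>triangles_in 3 B. Z \<subseteq> X) \<and> (\<exists>W\<in>triangles_in 3 B. W \<subseteq> Y))"
proof
  assume "(\<exists>Z\<in>triangles_in 3 B. Z \<subseteq> X) \<and> (\<exists>W\<in>triangles_in 3 B. W \<subseteq> Y)"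
  then obtain Z W where Z: "Z \<in> triangles_in 3 B" and W: "W \<in> triangles_in 3 B"
      and disj: "Z \<inter> W = {}"
    using assms(4) by blast
  have B: "B \<in> triangles 5"
    using atLeastAtMost_15_in_triangles assms(1) by simp
  define z w where "z i = card (Z \<inter> level B i)" and "w i = card (W \<inter> level B i)" for i
  have zw: "z i + w i \<le> i" if "i \<le> 5" for i
    using card_Int_disjoint_le[OF _ disj, of "level B i"] card_level[OF B that]
    by (simp add: z_def w_def level_def)
  obtain a b c where abc: "1 \<le> a" "a < b" "b < c" "c \<le> 5" "1 \<le> z a" "2 \<le> z b" "3 \<le> z c"
    unfolding z_def using triangles_in_3_5[OF Z B] .
  obtain a' b' c' where abc': "1 \<le> a'" "a' < b'" "b' < c'" "c' \<le> 5"
      "1 \<le> w a'" "2 \<le> w b'" "3 \<le> w c'"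
    unfolding w_def using triangles_in_3_5[OF W B] .
  have "c \<noteq> c'"
    \<comment> \<open>Two triples in one level would need capacity 6.\<close>
    using abc(4,7) abc'(7) zw[of c] by auto
  then consider "c < c'" | "c' < c" by linarith
  then show False
  proof cases
    case 1
    then show False
      using level_capacities_exceeded[of a b c c' a' b' z w] abc abc' zw by blast
  next
    case 2
    then show False
      \<comment> \<open>The symmetric case, with the roles of \<open>Z\<close> and \<open>W\<close>
        exchanged.\<close>
      using level_capacities_exceeded[of a' b' c' c a b w z] abc abc' zw by (simp add: add.commute)
  qed
qed

end
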